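(* Let $\mathcal D$ be the set of (closed) braid diagrams, for $L\in\mathcal D$ let $M(L)$ be its linking matrix in laundry order, and let $\mathcal M=\{M(L): L\in\mathcal D\}$ be the set of all linking matrices so obtained. Then the correspondence $L\leftrightarrow M(L)$ defines a bijection $\mathcal M\to\mathcal D$, $M(L)\mapsto L$, of the set of linking matrices onto the set of braid diagrams.
   Context: **Braid diagrams.** A closed braid diagram $L$ on $n\ge 1$ strands is given by $n$ and a finite (possibly empty) word in the letters $\sigma_1^{\pm1},\dots,\sigma_{n-1}^{\pm1}$. The braid is drawn vertically at the left of the picture, letters read from bottom to top, strands numbered from left to right, and is closed up around the right, so that the Seifert circles $C_1,\dots,C_n$ are concentric with $C_1$ outermost, numbered from left to right as seen at the left. Column $i$ is the region between $C_i$ and $C_{i+1}$; a letter $\sigma_i^{\pm1}$ is a crossing in column $i$. All circles are coherently oriented; $\sigma_i^{+1}$ is a positive and $\sigma_i^{-1}$ a negative crossing. Two words with the same $n$ give the same diagram iff they are related by the far commutations $\sigma_i^{\pm1}\sigma_j^{\pm1}=\sigma_j^{\pm1}\sigma_i^{\pm1}$ (any signs), $|i-j|>1$ (planar isotopy). No cancellation of letters and no cyclic permutation of words is allowed. $\mathcal D$ is the set of all these diagrams, over all $n\ge1$. **Bands and laundry order.** There is one circle band, denoted $C_i$, for each Seifert circle $C_i$ (placed at the top of the circle), and one twisted band $X$ for each crossing. A twisted band in column $i$ has one foot on $C_i$ and one on $C_{i+1}$ (one of these is even, one odd). For even $i$ let $f_i$ be the list of twisted-band feet met travelling up $C_i$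 (bottom to top); for odd $i$ let $s_i$ be the list of twisted-band feet met travelling down $C_i$ (top to bottom). Let $u_i,v_i$ be the first and second foot of the circle band $C_i$. The laundry ordering of the feet is $$(u_2 f_2 v_2\, u_4 f_4 v_4\cdots)(\cdots u_3 s_3 v_3\, u_1 s_1 v_1),$$ even circles increasing, then odd circles decreasing. The laundry order of the bands is the order of their first feet: $C_2$, the twisted bands meeting $C_2$ from bottom to top, $C_4$, the twisted bands meeting $C_4$ from bottom to top, $\dots$, then $\dots,C_3,C_1$. **The surface in laundry form.** $S'(L)\subset\mathbb R^3$ is a flat disk in the upper half of the $xy$-plane, with bands attached to it along the $x$-axis, the feet in the laundry ordering from left to right. The bands hang down, projecting to the lower half of the $xy$-plane, as on the pages of a three-page book: circle bands on the middle page, bands of odd columns on the page above (passing over), bands of even columns on the page below (passing under); bands on one page do not cross each other. Circle bands are untwisted. Each twisted band has one half twist, of sign $\pm1$ (its twist); the sign is the contribution of the half twist to $\mathrm{lk}(X',X)$ defined below, which is minus the sign of the crossing. **Linking matrix.** Each band determines a cycle, denoted by the same symbol: it runs once through the band and closes up in the disk, oriented counterclockwise. These cycles form a basis of $H_1(S'(L))$. $M(L)=(\mathrm{lk}(c_i',c_j))$, where $c_i,c_j$ run over the cycles in laundry order and $c'$ is $c$ pushed off the surface in both normal directions. Explicitly, $M(L)$ is symmetric, and its only possibly nonzero entries are: - diagonal: $\mathrm{lk}(X',X)=\pm1$ is the twist of the twisted band $X$ (the diagonal entries of circle bands are $0$); - (L1) if $X$ is a twisted band in column $i$, then $\mathrm{lk}(X',C_i)=-1$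 and $\mathrm{lk}(X',C_{i+1})=1$; - (L2) if $X,Y$ are twisted bands meeting a common circle and $X$ is above and to the left of $Y$, or below and to the right of $Y$ (in particular they are in adjacent columns), then $\mathrm{lk}(X',Y)=1$. Matrices in $\mathcal M$ are plain integer matrices, without labels on rows and columns. *)

theory Defs
  imports Main "Jordan_Normal_Form.Matrix"
begin

text \<open>\<open>Letter i True\<close> is \<open>\<sigma>\<^sub>i\<close> and \<open>Letter i False\<close> its inverse. The letter at position \<open>k\<close> of a
  word is the crossing at height \<open>k\<close>: words are read from bottom to top.\<close>

datatype braid_letter = Letter (column: nat) (positive: bool)

definition braid_words :: "(nat \<times> braid_letter list) set" where
  "braid_words = {(n, w). 1 \<le> n \<and> (\<forall>a \<in> set w. 1 \<le> column a \<and> column a < n)}"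

inductive far_commute :: "braid_letter list \<Rightarrow> braid_letter list \<Rightarrow> bool" where
  "\<bar>int (column a) - int (column b)\<bar> > 1 \<Longrightarrow> far_commute (u @ a # b # v) (u @ b # a # v)"

definition diagram_rel :: "(nat \<times> braid_letter list) rel" where
  "diagram_rel = {((m, w), (n, w')). (m, w) \<in> braid_words \<and> (n, w') \<in> braid_words \<and>
      m = n \<and> far_commute\<^sup>*\<^sup>* w w'}"

lemma equiv_diagram_rel: "equiv braid_words diagram_rel"
proof (rule equivI)
  have "far_commute w' w" if "far_commute w w'" for w w'
    using that by cases (auto intro!: far_commute.intros simp: abs_minus_commute)
  then have "symp far_commute"
    by (auto intro: sympI)
  then have "symp far_commute\<^sup>*\<^sup>*"
    by (rule symp_rtranclp)
  then show "sym diagram_rel"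
    by (auto simp: sym_def diagram_rel_def dest: sympD)
  show "trans diagram_rel"
    by (auto simp: trans_def diagram_rel_def)
qed (auto simp: refl_on_def diagram_rel_def)

definition braid_diagrams :: "(nat \<times> braid_letter list) set set" where
  "braid_diagrams = braid_words // diagram_rel"

text \<open>\<open>Circle c\<close> is the circle band at the Seifert circle \<open>C\<^sub>c\<close> (circles are numbered from \<open>1\<close>), and
  \<open>Crossing k\<close> is the twisted band at position \<open>k\<close> of the word (numbered from \<open>0\<close>).\<close>

datatype band = Circle nat | Crossing nat

definition meets :: "braid_letter list \<Rightarrow> nat \<Rightarrow> nat \<Rightarrow> bool" where
  "meets w k c \<longleftrightarrow> c = column (w ! k) \<or> c = column (w ! k) + 1"

definition crossings_up :: "braid_letter list \<Rightarrow> nat \<Rightarrow> band list" where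
  "crossings_up w c = map Crossing (filter (\<lambda>k. meets w k c) [0..<length w])"

text \<open>The laundry ordering of the feet; each foot is represented by its band, so that every band
  is listed twice.\<close>

definition circle_feet :: "braid_letter list \<Rightarrow> nat \<Rightarrow> band list" where
  "circle_feet w c =
     [Circle c] @ (if even c then crossings_up w c else rev (crossings_up w c)) @ [Circle c]"

definition laundry_feet :: "nat \<Rightarrow> braid_letter list \<Rightarrow> band list" where
  "laundry_feet n w =
     concat (map (circle_feet w) (filter even [1..<n + 1])) @
     concat (map (circle_feet w) (rev (filter odd [1..<n + 1])))"

text \<open>The bands in the order of their first feet: \<^const>\<open>remdups\<close> keeps last occurrences,
  hence the two reversals.\<close>

definition laundry_bands :: "nat \<Rightarrow> braid_letter list \<Rightarrow> band list" where
  "laundry_bands n w = rev (remdups (rev (laundry_feet n w)))"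

definition twist :: "braid_letter \<Rightarrow> int" where
  "twist a = (if positive a then - 1 else 1)"

definition above_left :: "braid_letter list \<Rightarrow> nat \<Rightarrow> nat \<Rightarrow> bool" where
  "above_left w k l \<longleftrightarrow> k > l \<and> column (w ! k) < column (w ! l)"

text \<open>\<open>lk w a b\<close> is the linking number of the two-sided push-off of the cycle of \<open>a\<close> with the cycle
  of \<open>b\<close>, on the surface in laundry form.\<close>

fun lk :: "braid_letter list \<Rightarrow> band \<Rightarrow> band \<Rightarrow> int" where
  "lk w (Circle c) (Circle d) = 0"
| "lk w (Crossing k) (Circle c) =
     (if c = column (w ! k) then - 1 else if c = column (w ! k) + 1 then 1 else 0)"
| "lk w (Circle c) (Crossing k) =
     (if c = column (w ! k) then - 1 else if c = column (w ! k) + 1 then 1 else 0)"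
| "lk w (Crossing k) (Crossing l) =
     (if k = l then twist (w ! k)
      else if (\<exists>c. meets w k c \<and> meets w l c) \<and> (above_left w k l \<or> above_left w l k) then 1
      else 0)"

definition word_linking_matrix :: "nat \<times> braid_letter list \<Rightarrow> int mat" where
  "word_linking_matrix = (\<lambda>(n, w). let bs = laundry_bands n w in
     mat (length bs) (length bs) (\<lambda>(i, j). lk w (bs ! i) (bs ! j)))"

text \<open>A junk value unless all words of the diagram \<open>L\<close> have the same matrix.\<close>

definition linking_matrix :: "(nat \<times> braid_letter list) set \<Rightarrow> int mat" where
  "linking_matrix L = the_elem (word_linking_matrix ` L)"

definition linking_matrices :: "int mat set" where
  "linking_matrices = linking_matrix ` braid_diagrams"

end

theory Submission imports Defs "HOL-Combinatorics.Transposition" begin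

text \<open>
  Far commutation never exchanges two crossings in equal or adjacent columns, and this is its only
  restriction: a word up to far commutation is the same thing as the family of its subwords in two
  adjacent columns (\<open>far_commutes_if_column_pairs_eq\<close>; an instance of the projection lemma for
  partially commutative monoids). So a diagram consists of its number of strands, the letters,
  and the relative heights of the pairs of crossings in equal or adjacent columns.

  All of this can be read off the matrix. A diagonal entry is \<open>0\<close> exactly for circle bands, so the
  diagonal gives the number of strands and also, since the circles occur in a known order, says
  which rows belong to which circle. In the row of a crossing the diagonal entry is minus its sign, and
  the entry \<open>- 1\<close> in the columns of circle bands is at the left circle that it meets, which gives
  its column. Two crossings in adjacent columns have linking number \<open>1\<close> if the left one is higher
  and \<open>0\<close> otherwise, which gives their relative height. The matrix says nothing about two crossings
  in the same column beyond their places in the laundry order; but each column borders exactly one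
  even circle, all its crossings are listed at that circle for the first time, and even circles are
  travelled upwards (\<open>column_of_laundry_bands\<close>).

  To compare two words with the same matrix (\<open>same_matrix_imp_same_diagram\<close>), match their bands by
  their places in the laundry order. The matching preserves circles, letters and all relative
  heights just mentioned, so it carries each subword in two adjacent columns to the other one.

  Conversely, exchanging two neighbouring far crossings renames their bands: no circle meets both,
  so neither the order of the feet on any circle nor any linking number changes
  (\<open>word_linking_matrix_far_commute\<close>).
\<close>

section \<open>Words up to far commutation\<close>

definition column_pair :: "nat \<Rightarrow> braid_letter list \<Rightarrow> braid_letter list" where
  "column_pair c w = filter (\<lambda>a. column a = c \<or> column a = c + 1) w"

lemma far_commute_append_left:
  assumes "far_commute w w'"
  shows "far_commute (x @ w) (x @ w')"
  using assms
proof cases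
  case (1 a b u v)
  then show ?thesis
    using far_commute.intros[of a b "x @ u" v] by simp
qed

lemma far_commutes_Cons: "far_commute\<^sup>*\<^sup>* w w' \<Longrightarrow> far_commute\<^sup>*\<^sup>* (a # w) (a # w')"
  by (induction rule: rtranclp_induct)
    (auto intro: rtranclp.rtrancl_into_rtrancl dest: far_commute_append_left[of _ _ "[a]"])

lemma far_commutes_sym: "far_commute\<^sup>*\<^sup>* w w' \<Longrightarrow> far_commute\<^sup>*\<^sup>* w' w"
proof -
  have "far_commute w' w" if "far_commute w w'" for w w'
    using that by cases (auto intro!: far_commute.intros simp: abs_minus_commute)
  then have "symp far_commute\<^sup>*\<^sup>*"
    by (intro symp_rtranclp sympI)
  then show "far_commute\<^sup>*\<^sup>* w w' \<Longrightarrow> far_commute\<^sup>*\<^sup>* w' w"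
    by (rule sympD)
qed

lemma far_commutes_move_to_front:
  assumes "\<forall>b \<in> set x. \<bar>int (column b) - int (column a)\<bar> > 1"
  shows "far_commute\<^sup>*\<^sup>* (x @ a # y) (a # x @ y)"
  using assms
proof (induction x)
  case (Cons b x)
  then have "far_commute\<^sup>*\<^sup>* (b # x @ a # y) (b # a # x @ y)"
    by (intro far_commutes_Cons) auto
  moreover have "far_commute (b # a # x @ y) (a # b # x @ y)"
    using far_commute.intros[of b a "[]" "x @ y"] Cons.prems by simp
  ultimately show ?case by simp
qed simp

text \<open>Induction on the first word. Its first letter \<open>a\<close> must also be the first letter in the other word
  among those in the column of \<open>a\<close> or next to it, because that letter and \<open>a\<close> are both first in
  the same subword. Hence it can be moved to the front.\<close>

lemma far_commutes_if_column_pairs_eq: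
  assumes "\<And>c. column_pair c w = column_pair c w'"
  shows "far_commute\<^sup>*\<^sup>* w w'"
  using assms
proof (induction w arbitrary: w')
  case Nil
  have "w' = []"
  proof (cases w')
    case (Cons b v)
    then show ?thesis using Nil[of "column b"] by (simp add: column_pair_def)
  qed
  then show ?case by simp
next
  case (Cons a u)
  let ?near = "\<lambda>b. \<bar>int (column b) - int (column a)\<bar> \<le> 1"
  have "a \<in> set (column_pair (column a) w')"
    using Cons.prems[of "column a", symmetric] by (simp add: column_pair_def)
  then have "\<exists>b \<in> set w'. ?near b"
    by (intro bexI[of _ a]) (auto simp: column_pair_def)
  then obtain x b y where w': "w' = x @ b # y" and b: "?near b"
    and x: "\<forall>z \<in> set x. \<not> ?near z"
    by (rule split_list_first_propE)
  \<comment> \<open>a pair of adjacent columns that contains both \<open>a\<close> and \<open>b\<close>\<close>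
  define c where "c = min (column a) (column b)"
  have c: "column a = c \<or> column a = c + 1" "column b = c \<or> column b = c + 1"
    using b by (auto simp: c_def min_def)
  have "column_pair c x = []"
    using x c by (auto simp: column_pair_def filter_empty_conv)
  then have "b = a"
    using Cons.prems[of c] c by (simp add: w' column_pair_def)
  have moved: "far_commute\<^sup>*\<^sup>* w' (a # x @ y)"
    unfolding w' \<open>b = a\<close> using x by (intro far_commutes_move_to_front) auto
  have "column_pair d u = column_pair d (x @ y)" for d
  proof (cases "column a = d \<or> column a = d + 1")
    case True
    then have "column_pair d x = []"
      using x by (auto simp: column_pair_def filter_empty_conv)
    then show ?thesis
      using Cons.prems[of d] True by (simp add: w' \<open>b = a\<close> column_pair_def)
  next
    case False
    then show ?thesis
      using Cons.prems[of d] by (simp add: w' \<open>b = a\<close> column_pair_def)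
  qed
  then have "far_commute\<^sup>*\<^sup>* u (x @ y)"
    by (rule Cons.IH)
  then have "far_commute\<^sup>*\<^sup>* (a # u) (a # x @ y)"
    by (rule far_commutes_Cons)
  then show ?case
    using far_commutes_sym[OF moved] by simp
qed

section \<open>First occurrences in a list\<close>

definition first_occurrences :: "'a list \<Rightarrow> 'a list" where
  "first_occurrences xs = rev (remdups (rev xs))"

lemma set_first_occurrences [simp]: "set (first_occurrences xs) = set xs"
  by (simp add: first_occurrences_def)

lemma distinct_first_occurrences [simp]: "distinct (first_occurrences xs)"
  by (simp add: first_occurrences_def)

lemma filter_first_occurrences:
  "filter P (first_occurrences xs) = first_occurrences (filter P xs)"
  by (simp add: first_occurrences_def rev_filter remdups_filter)

lemma first_occurrences_map_inj:
  assumes "inj f"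
  shows "first_occurrences (map f xs) = map f (first_occurrences xs)"
proof -
  have "remdups (map f ys) = map f (remdups ys)" for ys
    by (induction ys) (auto simp: inj_image_mem_iff[OF assms])
  then show ?thesis
    by (simp add: first_occurrences_def rev_map)
qed

lemma first_occurrences_append_subset:
  assumes "set ys \<subseteq> set xs" and "distinct xs"
  shows "first_occurrences (xs @ ys) = xs"
proof -
  have "remdups (zs @ rev xs) = rev xs" if "set zs \<subseteq> set xs" for zs
    using that assms(2) by (induction zs) auto
  then show ?thesis
    using assms(1) by (simp add: first_occurrences_def)
qed

lemma first_occurrences_doubled:
  assumes "distinct xs"
  shows "first_occurrences (concat (map (\<lambda>x. [x, x]) xs)) = xs"
  using assms
  by (induction xs rule: rev_induct) (auto simp: first_occurrences_def)

lemma concat_map_single: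
  assumes "distinct cs" "c \<in> set cs" "\<And>d. d \<in> set cs \<Longrightarrow> d \<noteq> c \<Longrightarrow> F d = []"
  shows "concat (map F cs) = F c"
proof -
  obtain xs ys where cs: "cs = xs @ c # ys"
    using assms(2) by (meson split_list)
  then have "concat (map F xs) = []" "concat (map F ys) = []"
    using assms by auto
  then show ?thesis by (simp add: cs del: concat_eq_Nil_conv)
qed

section \<open>The laundry order\<close>

lemma laundry_bands_eq: "laundry_bands n w = first_occurrences (laundry_feet n w)"
  by (simp add: laundry_bands_def first_occurrences_def)

fun is_circle :: "band \<Rightarrow> bool" where
  "is_circle (Circle c) = True"
| "is_circle (Crossing k) = False"

fun in_column :: "braid_letter list \<Rightarrow> nat \<Rightarrow> band \<Rightarrow> bool" where
  "in_column w i (Circle c) = False"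
| "in_column w i (Crossing k) = (column (w ! k) = i)"

definition laundry_circles :: "nat \<Rightarrow> nat list" where
  "laundry_circles n = filter even [1..<n + 1] @ rev (filter odd [1..<n + 1])"

lemma laundry_feet_eq: "laundry_feet n w = concat (map (circle_feet w) (laundry_circles n))"
  by (simp add: laundry_feet_def laundry_circles_def)

lemma distinct_laundry_circles: "distinct (laundry_circles n)"
  by (auto simp: laundry_circles_def)

lemma set_laundry_circles: "set (laundry_circles n) = {1..n}"
  by (auto simp: laundry_circles_def)

lemma length_laundry_circles: "length (laundry_circles n) = n"
  using distinct_card[OF distinct_laundry_circles[of n]] by (simp add: set_laundry_circles)

lemma set_circle_feet:
  "set (circle_feet w c) = insert (Circle c) (Crossing ` {k. k < length w \<and> meets w k c})"
  by (auto simp: circle_feet_def crossings_up_def)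

text \<open>Every crossing is listed because both circles that it meets, numbered by its column and the
  next number, are among the \<open>n\<close> circles.\<close>

lemma set_laundry_bands:
  assumes "(n, w) \<in> braid_words"
  shows "set (laundry_bands n w) = Circle ` {1..n} \<union> Crossing ` {..<length w}"
proof -
  have "1 \<le> column (w ! k) \<and> column (w ! k) < n" if "k < length w" for k
    using assms that by (auto simp: braid_words_def)
  then have "\<exists>c \<in> {1..n}. meets w k c" if "k < length w" for k
    using that by (intro bexI[of _ "column (w ! k)"]) (auto simp: meets_def less_imp_le)
  then have "(\<Union>c \<in> {1..n}. {k. k < length w \<and> meets w k c}) = {..<length w}"
    by auto
  moreover have "set (laundry_bands n w) = (\<Union>c \<in> {1..n}. set (circle_feet w c))"
    by (simp add: laundry_bands_eq laundry_feet_eq set_laundry_circles)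
  then have "set (laundry_bands n w) =
      Circle ` {1..n} \<union> Crossing ` (\<Union>c \<in> {1..n}. {k. k < length w \<and> meets w k c})"
    unfolding set_circle_feet by auto
  ultimately show ?thesis
    by (simp only:)
qed

text \<open>Taking first occurrences commutes with filtering, so the places of one kind of band can be
  found from the feet of that kind alone.\<close>

lemma circles_of_laundry_bands:
  "filter is_circle (laundry_bands n w) = map Circle (laundry_circles n)"
proof -
  have "filter is_circle (circle_feet w c) = map Circle [c, c]" for c
    by (auto simp: circle_feet_def crossings_up_def filter_empty_conv)
  then have "filter is_circle (laundry_feet n w)
      = map Circle (concat (map (\<lambda>c. [c, c]) (laundry_circles n)))"
    by (simp add: laundry_feet_eq filter_concat map_concat comp_def)
  then show ?thesis
    by (simp add: laundry_bands_eq filter_first_occurrences first_occurrences_doubled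
        first_occurrences_map_inj inj_def distinct_laundry_circles)
qed

text \<open>The feet in column \<open>i\<close> lie on the circles \<open>i\<close> and \<open>i + 1\<close>. The even one of them comes first and
  lists the crossings of the column from bottom to top; the odd one lists them once more, from top
  to bottom, and adds no first occurrence.\<close>

lemma column_of_laundry_bands:
  assumes "1 \<le> i" "i < n"
  shows "filter (in_column w i) (laundry_bands n w)
    = map Crossing (filter (\<lambda>k. column (w ! k) = i) [0..<length w])" (is "_ = ?L")
proof -
  \<comment> \<open>the even and the odd circle at column \<open>i\<close>\<close>
  define e where "e = (if even i then i else i + 1)"
  define d where "d = (if even i then i + 1 else i)"
  let ?F = "\<lambda>c. filter (in_column w i) (circle_feet w c)"
  have up: "filter (in_column w i) (crossings_up w c) = (if c = i \<or> c = i + 1 then ?L else [])" for c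
    by (auto simp: crossings_up_def filter_map comp_def filter_empty_conv meets_def
        intro!: arg_cong[of _ _ "map Crossing"] filter_cong)
  have F: "?F c = (if c = e then ?L else if c = d then rev ?L else [])" for c
    using up[of c] by (auto simp: circle_feet_def e_def d_def rev_filter[symmetric])
  have e: "e \<in> set (filter even [1..<n + 1])" "d \<notin> set (filter even [1..<n + 1])"
    and d: "d \<in> set (filter odd [1..<n + 1])" "e \<notin> set (filter odd [1..<n + 1])"
    unfolding set_filter set_upt using assms by (auto simp: e_def d_def)
  have other: "?F c = []" if "c \<noteq> e" "c \<noteq> d" for c
    using F[of c] that by simp
  have "concat (map ?F (filter even [1..<n + 1])) = ?F e"
  proof (rule concat_map_single)
    show "?F c = []" if "c \<in> set (filter even [1..<n + 1])" "c \<noteq> e" for c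
      using that e(2) by (intro other) metis+
  qed (use e(1) in \<open>simp_all only: distinct_filter distinct_upt\<close>)
  moreover have "concat (map ?F (rev (filter odd [1..<n + 1]))) = ?F d"
  proof (rule concat_map_single)
    show "?F c = []" if "c \<in> set (rev (filter odd [1..<n + 1]))" "c \<noteq> d" for c
      using that d(2) unfolding set_rev by (intro other) metis+
  qed (use d(1) in \<open>simp_all only: set_rev distinct_rev distinct_filter distinct_upt\<close>)
  ultimately have "filter (in_column w i) (laundry_feet n w) = ?F e @ ?F d"
    by (simp add: laundry_feet_def filter_concat comp_def)
  also have "\<dots> = ?L @ rev ?L"
    by (simp add: F) (auto simp: e_def d_def)
  finally show ?thesis
    by (simp add: laundry_bands_eq filter_first_occurrences first_occurrences_append_subset
        distinct_map inj_on_def)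
qed

section \<open>Invariance of the matrix under far commutation\<close>

fun relabel :: "(nat \<Rightarrow> nat) \<Rightarrow> band \<Rightarrow> band" where
  "relabel f (Circle c) = Circle c"
| "relabel f (Crossing k) = Crossing (f k)"

text \<open>The exchange of the letters at heights \<open>p\<close> and \<open>p + 1\<close> renames the crossings by a transposition.
  It is monotone on the crossings at any one circle, since \<open>p\<close> and \<open>p + 1\<close> do not meet a common
  circle; therefore it preserves the linking numbers and carries one laundry order to the other.\<close>

lemma word_linking_matrix_far_commute:
  assumes "far_commute w w'"
  shows "word_linking_matrix (n, w) = word_linking_matrix (n, w')"
  using assms
proof cases
  case (1 a b u v)
  define p where "p = length u"
  define t where "t = transpose p (Suc p)"
  have t_p: "t p = Suc p" "t (Suc p) = p"
    by (simp_all add: t_def)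
  have t_other: "t k = k" if "k \<noteq> p" "k \<noteq> Suc p" for k
    using that by (simp add: t_def)
  have inj_t: "inj t"
    by (simp add: t_def)
  have inj: "inj (relabel t)"
  proof (rule injI)
    show "x = y" if "relabel t x = relabel t y" for x y
      using that by (cases x; cases y) (auto dest: injD[OF inj_t])
  qed
  have nth: "w' ! t k = w ! k" for k
  proof -
    consider "k = p" | "k = Suc p" | "k < p" | m where "k = p + Suc (Suc m)"
      by (metis add_Suc_right less_iff_Suc_add linorder_neqE_nat old.nat.exhaust
          add_0_right)
    then show ?thesis
    proof cases
      case 1
      then show ?thesis by (simp add: t_p) (simp add: \<open>w = _\<close> \<open>w' = _\<close> nth_append p_def)
    next
      case 2
      then show ?thesis by (simp add: t_p) (simp add: \<open>w = _\<close> \<open>w' = _\<close> nth_append p_def)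
    next
      case 3
      then show ?thesis by (simp add: t_other) (simp add: \<open>w = _\<close> \<open>w' = _\<close> nth_append p_def)
    next
      case (4 m)
      then show ?thesis by (simp add: t_other) (simp add: \<open>w = _\<close> \<open>w' = _\<close> nth_append p_def)
    qed
  qed
  have meets: "meets w' (t k) c \<longleftrightarrow> meets w k c" for k c
    by (simp add: meets_def nth)
  have far: "\<not> (meets w p c \<and> meets w (Suc p) c)" for c
    using 1 by (auto simp: meets_def nth_append p_def)
  have order: "t k < t l \<longleftrightarrow> k < l" if "meets w k c" "meets w l c" for k l c
    using that far[of c] by (auto simp: t_def transpose_def)
  have lk: "lk w' (relabel t x) (relabel t y) = lk w x y" for x y
  proof (cases x)
    case (Circle c)
    then show ?thesis by (cases y) (simp_all add: nth)
  next
    case x: (Crossing k)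
    show ?thesis
    proof (cases y)
      case (Circle c)
      then show ?thesis by (simp add: x nth)
    next
      case y: (Crossing l)
      have "(\<exists>c. meets w k c \<and> meets w l c) \<and> (above_left w' (t k) (t l) \<or> above_left w' (t l) (t k))
        \<longleftrightarrow> (\<exists>c. meets w k c \<and> meets w l c) \<and> (above_left w k l \<or> above_left w l k)"
        using order by (auto simp: above_left_def nth)
      then show ?thesis
        by (simp add: x y nth meets inj_eq[OF inj_t])
    qed
  qed
  have upt: "[0..<length w] = [0..<p] @ [p, Suc p] @ [Suc (Suc p)..<length w]"
  proof -
    have "p < length w" "Suc p < length w"
      by (simp_all add: 1 p_def)
    then show ?thesis
      using upt_add_eq_append[of 0 p "length w - p"] by (simp add: upt_conv_Cons)
  qed
  have len: "length w' = length w"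
    by (simp add: 1)
  have "crossings_up w' c = map (relabel t) (crossings_up w c)" for c
  proof -
    have fixed: "filter (\<lambda>k. meets w' k c) ks = map t (filter (\<lambda>k. meets w k c) ks)"
      if "p \<notin> set ks" "Suc p \<notin> set ks" for ks
      using that
    proof (induction ks)
      case (Cons k ks)
      then show ?case using meets[of k c] by (simp add: t_other)
    qed simp
    have "filter (\<lambda>k. meets w' k c) [p, Suc p] = map t (filter (\<lambda>k. meets w k c) [p, Suc p])"
      using far[of c] meets[of p c] meets[of "Suc p" c] by (auto simp: t_p)
    then have "filter (\<lambda>k. meets w' k c) [0..<length w'] = map t (filter (\<lambda>k. meets w k c) [0..<length w])"
      unfolding len upt filter_append map_append by (simp add: fixed)
    then show ?thesis
      by (simp add: crossings_up_def)
  qed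
  then have "circle_feet w' = (\<lambda>c. map (relabel t) (circle_feet w c))"
    by (intro ext) (simp add: circle_feet_def rev_map)
  then have "laundry_feet n w' = map (relabel t) (laundry_feet n w)"
    by (simp add: laundry_feet_eq map_concat comp_def)
  then have "laundry_bands n w' = map (relabel t) (laundry_bands n w)"
    by (simp add: laundry_bands_eq first_occurrences_map_inj[OF inj])
  then show ?thesis
    by (auto simp: word_linking_matrix_def Let_def lk intro!: eq_matI)
qed

lemma word_linking_matrix_far_commutes:
  assumes "far_commute\<^sup>*\<^sup>* w w'"
  shows "word_linking_matrix (n, w) = word_linking_matrix (n, w')"
  using assms by (induction rule: rtranclp_induct) (auto dest: word_linking_matrix_far_commute)

section \<open>Reading the diagram off the matrix\<close>

lemma ex_map_eq:
  assumes "distinct xs" "length xs = length ys"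
  shows "\<exists>g. map g xs = ys"
proof
  show "map (\<lambda>x. the (map_of (zip xs ys) x)) xs = ys"
    using assms by (auto intro!: nth_equalityI simp: map_of_zip_nth)
qed

lemma sorted_map_le:
  assumes "sorted xs" "sorted (map f xs)" "k \<in> set xs" "l \<in> set xs" "k < l"
  shows "f k \<le> f l"
proof -
  obtain i j where ij: "i < length xs" "xs ! i = k" "j < length xs" "xs ! j = l"
    using assms(3,4) by (metis in_set_conv_nth)
  have "i < j"
    using sorted_nth_mono[OF assms(1), of j i] ij assms(5) by (meson leD leI)
  then show ?thesis
    using sorted_nth_mono[OF assms(2), of i j] ij by simp
qed

text \<open>Crossings in adjacent columns share the circle between them, so their linking number always
  tells which of them is higher.\<close>

lemma lk_crossings_adjacent:
  assumes "column (w ! l) = column (w ! k) + 1"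
  shows "lk w (Crossing k) (Crossing l) = (if l < k then 1 else 0)"
proof -
  have "meets w k (column (w ! l))" "meets w l (column (w ! l))" "k \<noteq> l"
    using assms by (auto simp: meets_def)
  then show ?thesis
    using assms by (auto simp: above_left_def)
qed

lemma lk_sym: "lk w x y = lk w y x"
  by (cases x; cases y) auto

lemma column_pair_positions:
  "column_pair c w = map ((!) w) 
    (filter (\<lambda>k. column (w ! k) = c \<or> column (w ! k) = c + 1) [0..<length w])"
proof -
  have "column_pair c (map ((!) w) [0..<length w]) = map ((!) w)
      (filter (\<lambda>k. column (w ! k) = c \<or> column (w ! k) = c + 1) [0..<length w])"
    by (simp only: column_pair_def filter_map comp_def)
  then show ?thesis
    by (simp only: map_nth)
qed

lemma same_matrix_imp_same_diagram:
  assumes "(n, w) \<in> braid_words" "(n', w') \<in> braid_words"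
    and eq: "word_linking_matrix (n, w) = word_linking_matrix (n', w')"
  shows "n = n'" "far_commute\<^sup>*\<^sup>* w w'"
proof -
  let ?bs = "laundry_bands n w" and ?bs' = "laundry_bands n' w'"
  have len: "length ?bs = length ?bs'"
    using arg_cong[OF eq, of dim_row] by (simp add: word_linking_matrix_def Let_def)
  have dist: "distinct ?bs" "distinct ?bs'"
    by (simp_all add: laundry_bands_eq)
  \<comment> \<open>\<open>g\<close> matches bands at equal places in the two laundry orders\<close>
  obtain g where g: "map g ?bs = ?bs'"
    using ex_map_eq[OF dist(1) len] by blast
  have g_inj: "inj_on g (set ?bs)"
    using dist(2) unfolding g[symmetric] by (simp add: distinct_map)
  have g_lk: "lk w' (g x) (g y) = lk w x y" if xy: "x \<in> set ?bs" "y \<in> set ?bs" for x y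
  proof -
    obtain i j where i: "i < length ?bs" "x = ?bs ! i" and j: "j < length ?bs" "y = ?bs ! j"
      using xy by (metis in_set_conv_nth)
    have "?bs' ! i = g x" "?bs' ! j = g y"
      unfolding g[symmetric] using i j by simp_all
    then show ?thesis
      using arg_cong[OF eq, of "\<lambda>M. M $$ (i, j)"] i j len
      by (simp add: word_linking_matrix_def Let_def)
  qed
  have lk_diag: "is_circle x \<longleftrightarrow> lk v x x = 0" for v x
    by (cases x) (simp_all add: twist_def)
  have g_circle: "is_circle (g x) \<longleftrightarrow> is_circle x" if "x \<in> set ?bs" for x
    using g_lk[OF that that] by (simp only: lk_diag[of "g x" w'] lk_diag[of x w])
  have "filter is_circle ?bs' = map g (filter is_circle ?bs)"
    unfolding g[symmetric] by (simp add: filter_map g_circle cong: filter_cong)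
  then have circles: "map Circle (laundry_circles n') = map (g \<circ> Circle) (laundry_circles n)"
    by (simp add: circles_of_laundry_bands)
  show n: "n = n'"
    using arg_cong[OF circles, of length] by (simp add: length_laundry_circles)
  have g_Circle: "g (Circle c) = Circle c" if "1 \<le> c" "c \<le> n" for c
    using circles that set_laundry_circles[of n] unfolding n by auto
  note set_bs = set_laundry_bands[OF assms(1)] and set_bs' = set_laundry_bands[OF assms(2)]
  \<comment> \<open>\<open>f\<close> is the effect of \<open>g\<close> on heights\<close>
  have "\<exists>k'. g (Crossing k) = Crossing k'" if "k < length w" for k
    using g_circle[of "Crossing k"] that by (cases "g (Crossing k)") (auto simp: set_bs)
  then obtain f where f: "\<And>k. k < length w \<Longrightarrow> g (Crossing k) = Crossing (f k)"
    by metis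
  have letters: "w' ! f k = w ! k" and f_less: "f k < length w'" if k: "k < length w" for k
  proof -
    have mem: "Crossing k \<in> set ?bs"
      using k by (simp add: set_bs)
    have "g (Crossing k) \<in> set ?bs'"
      unfolding g[symmetric] using mem by simp
    then show "f k < length w'"
      using k by (auto simp: f set_bs')
    have col: "1 \<le> column (w ! k)" "column (w ! k) < n"
      using assms(1) k by (auto simp: braid_words_def)
    \<comment> \<open>only the left circle at a crossing has linking number \<open>- 1\<close> with it\<close>
    have "lk w' (g (Crossing k)) (g (Circle (column (w ! k)))) = - 1"
      using col mem by (subst g_lk) (auto simp: set_bs)
    then have "column (w' ! f k) = column (w ! k)"
      using col k by (simp add: g_Circle f split: if_splits)
    moreover have "positive (w' ! f k) = positive (w ! k)"
      using g_lk[OF mem mem] k by (simp add: f twist_def split: if_splits)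
    ultimately show "w' ! f k = w ! k"
      by (simp add: braid_letter.expand)
  qed
  have f_inj: "k = l" if "k < length w" "l < length w" "f k = f l" for k l
    using inj_onD[OF g_inj, of "Crossing k" "Crossing l"] that by (simp add: f set_bs)
  have f_surj: "\<exists>k < length w. f k = m" if m: "m < length w'" for m
  proof -
    have "Crossing m \<in> g ` set ?bs"
      using m set_bs' unfolding g[symmetric] by auto
    then show ?thesis
      using g_Circle f by (auto simp: set_bs)
  qed
  let ?col = "\<lambda>v i. filter (\<lambda>k. column (v ! k) = i) [0..<length v]"
  have same_column: "f k < f l"
    if kl: "k < l" "l < length w" "column (w ! k) = column (w ! l)" for k l
  proof -
    define i where "i = column (w ! l)"
    have i: "1 \<le> i" "i < n"
      using assms(1) kl by (auto simp: braid_words_def i_def)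
    \<comment> \<open>\<open>g\<close> carries column \<open>i\<close> to column \<open>i\<close>, and each laundry order lists it from bottom to top\<close>
    have *: "in_column w' i (g x) \<longleftrightarrow> in_column w i x" if "x \<in> set ?bs" for x
      using that by (auto simp: set_bs f letters g_Circle)
    have "filter (in_column w' i) ?bs' = map g (filter (in_column w i) ?bs)"
      unfolding g[symmetric] by (simp add: filter_map * cong: filter_cong)
    then have "map Crossing (?col w' i) = map g (map Crossing (?col w i))"
      using column_of_laundry_bands[OF i, of w] column_of_laundry_bands[OF i, of w']
      by (simp only: n)
    also have "\<dots> = map Crossing (map f (?col w i))"
      by (auto simp: f)
    finally have "?col w' i = map f (?col w i)"
      by (subst (asm) inj_map_eq_map) (simp_all add: inj_def)
    moreover have "sorted (?col w' i)"
      by (simp add: sorted_wrt_filter)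
    ultimately have sorted: "sorted (map f (?col w i))"
      by simp
    have "f k \<le> f l"
      by (rule sorted_map_le[OF _ sorted]) (use kl in \<open>auto simp: sorted_wrt_filter i_def\<close>)
    then show ?thesis
      using f_inj[of k l] kl by fastforce
  qed
  have f_mono: "f k < f l"
    if kl: "k < l" "l < length w"
      and c: "column (w ! k) = c \<or> column (w ! k) = c + 1" "column (w ! l) = c \<or> column (w ! l) = c + 1"
    for k l c
  proof -
    have k: "k < length w" using kl by simp
    have mem: "Crossing k \<in> set ?bs" "Crossing l \<in> set ?bs"
      using kl by (auto simp: set_bs)
    have ne: "f k \<noteq> f l"
      using f_inj[of k l] kl by auto
    have lk: "lk w' (Crossing (f k)) (Crossing (f l)) = lk w (Crossing k) (Crossing l)"
      using g_lk[OF mem] k kl(2) by (simp only: f)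
    consider "column (w ! k) = column (w ! l)" | "column (w ! l) = column (w ! k) + 1"
      | "column (w ! k) = column (w ! l) + 1"
      using c by auto
    then show ?thesis
    proof cases
      case 1
      then show ?thesis using same_column kl by blast
    next
      case 2
      then show ?thesis
        using lk ne kl k
        by (simp add: lk_crossings_adjacent letters del: lk.simps split: if_splits)
    next
      case 3
      then show ?thesis
        using lk ne kl k
        by (simp add: lk_crossings_adjacent letters lk_sym[of _ "Crossing k"]
            lk_sym[of _ "Crossing (f k)"] del: lk.simps split: if_splits)
    qed
  qed
  have "column_pair c w = column_pair c w'" for c
  proof -
    let ?P = "\<lambda>v k. column (v ! k) = c \<or> column (v ! k) = c + 1"
    let ?ks = "\<lambda>v. filter (?P v) [0..<length v]"
    \<comment> \<open>two strictly increasing lists with the same elements are equal\<close>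
    have "sorted_wrt (<) (map f (?ks w))"
      unfolding sorted_wrt_map
    proof (rule sorted_wrt_mono_rel[of _ "(<)"])
      show "f k < f l" if "k \<in> set (?ks w)" "l \<in> set (?ks w)" "k < l" for k l
        using f_mono[of k l c] that by simp
    qed (simp add: sorted_wrt_filter)
    moreover have "sorted_wrt (<) (?ks w')"
      by (simp add: sorted_wrt_filter)
    moreover have "set (map f (?ks w)) = set (?ks w')"
    proof (intro equalityI subsetI)
      fix m assume "m \<in> set (map f (?ks w))"
      then show "m \<in> set (?ks w')"
        using letters f_less by auto
    next
      fix m assume m: "m \<in> set (?ks w')"
      then obtain k where "k < length w" "f k = m"
        using f_surj[of m] by auto
      then show "m \<in> set (map f (?ks w))"
        using m letters[of k] by auto
    qed
    ultimately have "map f (?ks w) = ?ks w'"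
      by (simp only: strict_sorted_iff sorted_distinct_set_unique)
    then have "column_pair c w' = map ((!) w') (map f (?ks w))"
      by (simp only: column_pair_positions)
    also have "\<dots> = map ((!) w) (?ks w)"
      using letters by simp
    finally show ?thesis
      by (simp only: column_pair_positions)
  qed
  then show "far_commute\<^sup>*\<^sup>* w w'"
    by (rule far_commutes_if_column_pairs_eq)
qed

section \<open>The correspondence between matrices and diagrams\<close>

theorem theorem1:
  shows "(\<forall>L \<in> braid_diagrams. \<forall>p \<in> L. word_linking_matrix p = linking_matrix L) \<and>
    (\<exists>\<Phi>. bij_betw \<Phi> linking_matrices braid_diagrams \<and>
         (\<forall>L \<in> braid_diagrams. \<Phi> (linking_matrix L) = L))"
proof -
  have matrix: "word_linking_matrix p = linking_matrix L" if L: "L \<in> braid_diagrams" and p: "p \<in> L" for L p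
  proof -
    have "word_linking_matrix q = word_linking_matrix p" if "q \<in> L" for q
    proof -
      have "(p, q) \<in> diagram_rel"
        using quotient_eq_iff[OF equiv_diagram_rel] L p that unfolding braid_diagrams_def by blast
      then show ?thesis
        using word_linking_matrix_far_commutes[of "snd p" "snd q" "fst p"]
        by (auto simp: diagram_rel_def)
    qed
    then have "word_linking_matrix ` L = {word_linking_matrix p}"
      using p by blast
    then show ?thesis
      by (simp add: linking_matrix_def)
  qed
  have "inj_on linking_matrix braid_diagrams"
  proof (rule inj_onI)
    fix L L' assume L: "L \<in> braid_diagrams" "L' \<in> braid_diagrams"
      and eq: "linking_matrix L = linking_matrix L'"
    have "\<exists>p \<in> braid_words. p \<in> K" if "K \<in> braid_diagrams" for K
      using that equiv_class_self[OF equiv_diagram_rel]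
      unfolding braid_diagrams_def quotient_def by auto
    then obtain p p' where p: "p \<in> L" "p \<in> braid_words" and p': "p' \<in> L'" "p' \<in> braid_words"
      using L by meson
    have "word_linking_matrix p = word_linking_matrix p'"
      using matrix[OF L(1) p(1)] matrix[OF L(2) p'(1)] eq by simp
    moreover obtain n w n' w' where "p = (n, w)" "p' = (n', w')"
      by fastforce
    ultimately have "(p, p') \<in> diagram_rel"
      using p(2) p'(2) same_matrix_imp_same_diagram[of n w n' w']
      by (auto simp: diagram_rel_def)
    then show "L = L'"
      using quotient_eq_iff[OF equiv_diagram_rel] L p p' unfolding braid_diagrams_def by blast
  qed
  then have bij: "bij_betw linking_matrix braid_diagrams linking_matrices"
    by (simp add: bij_betw_def linking_matrices_def)
  show ?thesis
  proof (intro conjI ballI exI)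
    show "bij_betw (the_inv_into braid_diagrams linking_matrix) linking_matrices braid_diagrams"
      by (rule bij_betw_the_inv_into[OF bij])
    show "the_inv_into braid_diagrams linking_matrix (linking_matrix L) = L"
      if "L \<in> braid_diagrams" for L
      using bij that by (simp add: bij_betw_def the_inv_into_f_f)
  qed (rule matrix)
qed

end
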